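(* For every integer $c\geq 0$ and every integer $s$ with $0\leq s\leq 3c$ and $s\neq 1$, there exist infinitely many connected signed graphs $(G,\sigma)$ with $c(G)=c$ such that $$\eta(G,\sigma)=|V(G)|-2m(G)+2c(G)-s.$$
   Context: All graphs are finite and simple. A signed graph $(G,\sigma)$ is a graph $G$ with a map $\sigma:E(G)\to\{+,-\}$; its adjacency matrix $A(G,\sigma)$ has $(i,j)$-entry $\sigma(v_iv_j)$ if $v_iv_j\in E(G)$ and $0$ otherwise. The nullity $\eta(G,\sigma)$ is the multiplicity of $0$ as an eigenvalue of $A(G,\sigma)$. $m(G)$ is the matching number of $G$, and $c(G)=|E(G)|-|V(G)|+\theta(G)$, where $\theta(G)$ is the number of connected components of $G$. *)

theory Defs
  imports "Jordan_Normal_Form.Char_Poly"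
begin

text \<open>
  A signed graph: vertices, edges as two-element vertex sets, and the sign map, with
  \<open>+\<close> and \<open>-\<close> encoded as the reals \<open>1\<close> and \<open>-1\<close>. The values of the sign map off the edge set
  are irrelevant: no definition below depends on them except equality of records.
\<close>

record 'a signed_graph =
  sg_verts :: "'a set"
  sg_edges :: "'a set set"
  sg_sign :: "'a set \<Rightarrow> real"

definition is_signed_graph :: "'a signed_graph \<Rightarrow> bool" where
  "is_signed_graph G \<longleftrightarrow>
     finite (sg_verts G) \<and>
     (\<forall>e \<in> sg_edges G. e \<subseteq> sg_verts G \<and> card e = 2) \<and>
     (\<forall>e \<in> sg_edges G. sg_sign G e \<in> {1, -1})"

definition sg_adj :: "'a signed_graph \<Rightarrow> 'a rel" where
  "sg_adj G = {(u, v). {u, v} \<in> sg_edges G}"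

definition sg_connected :: "'a signed_graph \<Rightarrow> bool" where
  "sg_connected G \<longleftrightarrow>
     sg_verts G \<noteq> {} \<and> (\<forall>u \<in> sg_verts G. \<forall>v \<in> sg_verts G. (u, v) \<in> (sg_adj G)\<^sup>*)"

definition sg_components :: "'a signed_graph \<Rightarrow> 'a set set" where
  "sg_components G = sg_verts G // ((sg_adj G)\<^sup>* \<inter> sg_verts G \<times> sg_verts G)"

definition cyclomatic_number :: "'a signed_graph \<Rightarrow> int" where
  "cyclomatic_number G =
     int (card (sg_edges G)) - int (card (sg_verts G)) + int (card (sg_components G))"

definition sg_matching :: "'a signed_graph \<Rightarrow> 'a set set \<Rightarrow> bool" where
  "sg_matching G M \<longleftrightarrow>
     M \<subseteq> sg_edges G \<and> (\<forall>e \<in> M. \<forall>f \<in> M. e \<noteq> f \<longrightarrow> e \<inter> f = {})"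

definition matching_number :: "'a signed_graph \<Rightarrow> nat" where
  "matching_number G = Max (card ` {M. sg_matching G M})"

text \<open>
  The vertices are enumerated in increasing order; any other enumeration gives a matrix that is
  permutation-similar to this one, hence with the same eigenvalues and multiplicities.
\<close>

definition sg_adj_matrix :: "'a::linorder signed_graph \<Rightarrow> real mat" where
  "sg_adj_matrix G =
     (let vs = sorted_list_of_set (sg_verts G); n = card (sg_verts G) in
      Matrix.mat n n (\<lambda>(i, j).
        if {vs ! i, vs ! j} \<in> sg_edges G then sg_sign G {vs ! i, vs ! j} else 0))"

definition sg_nullity :: "'a::linorder signed_graph \<Rightarrow> nat" where
  "sg_nullity G = Polynomial.order 0 (char_poly (sg_adj_matrix G))"

definition sg_isomorphic :: "'a signed_graph \<Rightarrow> 'b signed_graph \<Rightarrow> bool" where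
  "sg_isomorphic G H \<longleftrightarrow>
     (\<exists>f. bij_betw f (sg_verts G) (sg_verts H) \<and>
          (\<forall>u \<in> sg_verts G. \<forall>v \<in> sg_verts G.
             {u, v} \<in> sg_edges G \<longleftrightarrow> {f u, f v} \<in> sg_edges H) \<and>
          (\<forall>e \<in> sg_edges G. sg_sign H (f ` e) = sg_sign G e))"

end

theory Submission
  imports Defs
begin

text \<open>
  Four-vertex blocks are hung on a central vertex: triangles (with a leaf as fourth vertex)
  contribute 3 to \<open>s\<close>, unbalanced squares 2, balanced squares 0, and at least one block consists of
  leaves. Every \<open>s \<le> 3 c\<close> other than 1 is \<open>3 a + 2 b\<close> with \<open>a + b \<le> c\<close>; balanced squares make up the
  remaining cycles, and varying the number of leaf blocks gives infinitely many graphs.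
  For the nullity, let \<open>A\<close> be the adjacency matrix and \<open>x\<close> a small nonzero real. Eliminating one block
  \<open>B\<close> with star vector \<open>b\<close> from \<open>det (x I - A)\<close> splits off the factor \<open>det (x I - B)\<close> and lowers the
  diagonal entry at the centre by \<open>b\<^sup>T (x I - B)\<^sup>-\<^sup>1 b\<close>. These corrections have poles of nonnegative
  residue at 0, a positive one for leaves, so the centre contributes exactly one pole and the
  nullity is the sum of the block nullities minus 1.
\<close>

section \<open>Determinant, vanishing order and counting preliminaries\<close>

text \<open>The Schur complement formula, with a solution \<open>Z\<close> of
  \<open>D * Z = C\<close> in place of the inverse of \<open>D\<close> times \<open>C\<close>. The
  block matrix factors as a block upper triangular matrix times the unipotent matrix
  \<open>?E\<close>.\<close>

lemma det_four_block_mat_solve: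
  fixes A :: "'a :: idom mat"
  assumes A: "A \<in> carrier_mat n n" and B: "B \<in> carrier_mat n m"
    and D: "D \<in> carrier_mat m m" and Z: "Z \<in> carrier_mat m n"
  shows "det (four_block_mat A B (D * Z) D) = det (A - B * Z) * det D"
proof -
  have DZ: "D * Z \<in> carrier_mat m n" and BZ: "B * Z \<in> carrier_mat n n" using B D Z by auto
  let ?E = "four_block_mat (1\<^sub>m n) (0\<^sub>m n m) Z (1\<^sub>m m)"
  have ABZ: "A - B * Z \<in> carrier_mat n n" using minus_carrier_mat[OF BZ] .
  have "four_block_mat (A - B * Z) B (0\<^sub>m m n) D * ?E =
      four_block_mat ((A - B * Z) * 1\<^sub>m n + B * Z) ((A - B * Z) * 0\<^sub>m n m + B * 1\<^sub>m m)
        (0\<^sub>m m n * 1\<^sub>m n + D * Z) (0\<^sub>m m n * 0\<^sub>m n m + D * 1\<^sub>m m)"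
    by (rule mult_four_block_mat[OF ABZ B zero_carrier_mat D one_carrier_mat zero_carrier_mat Z one_carrier_mat])
  also have "\<dots> = four_block_mat A B (D * Z) D"
  proof (rule cong_four_block_mat)
    show "(A - B * Z) * 1\<^sub>m n + B * Z = A"
      unfolding right_mult_one_mat[OF ABZ] by (rule eq_matI) (use A B Z in auto)
    show "(A - B * Z) * 0\<^sub>m n m + B * 1\<^sub>m m = B"
      unfolding right_mult_zero_mat[OF ABZ] using B by simp
    show "0\<^sub>m m n * 1\<^sub>m n + D * Z = D * Z" using DZ by simp
    show "0\<^sub>m m n * 0\<^sub>m n m + D * 1\<^sub>m m = D" using D by simp
  qed
  finally have "det (four_block_mat A B (D * Z) D) =
      det (four_block_mat (A - B * Z) B (0\<^sub>m m n) D) * det ?E"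
    using det_mult[OF four_block_carrier_mat[OF ABZ D] four_block_carrier_mat[OF one_carrier_mat one_carrier_mat],
        of B "0\<^sub>m m n" "0\<^sub>m n m" Z] by simp
  then show ?thesis
    using det_four_block_mat_lower_left_zero[OF ABZ B refl D]
      det_four_block_mat_upper_right_zero[OF one_carrier_mat refl Z one_carrier_mat] by simp
qed

lemma poly_char_poly:
  fixes A :: "'a :: comm_ring_1 mat"
  assumes "A \<in> carrier_mat n n"
  shows "poly (char_poly A) x = det (x \<cdot>\<^sub>m 1\<^sub>m n - A)"
  unfolding char_poly_def
  by (rule poly_det_cong[of _ n]) (use assms in \<open>auto simp: char_poly_matrix_def\<close>)

text \<open>Reads the multiplicity of the root 0 off the behaviour of \<open>p\<close> near 0:
  \<open>p\<close> equals \<open>x ^ m * q\<close> with \<open>poly q 0\<close> nonzero, and the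
  exponents on both sides must agree. The power \<open>x ^ a\<close> allows a pole on the other side
  to be cleared first.\<close>

lemma order_0_from_asymptotics:
  fixes p :: "real poly"
  assumes eq: "eventually (\<lambda>x. poly p x * x ^ a = x ^ b * h x) (at 0)"
    and lim: "(h \<longlongrightarrow> l) (at 0)" and l: "l \<noteq> 0"
  shows "p \<noteq> 0" and "Polynomial.order 0 p + a = b"
proof -
  have nz: "eventually (\<lambda>x::real. x \<noteq> 0) (at 0)" by (simp add: eventually_at_filter)
  have hnz: "eventually (\<lambda>x. h x \<noteq> 0) (at 0)"
    using lim l by (metis tendsto_imp_eventually_ne)
  show p: "p \<noteq> 0"
  proof
    assume "p = 0"
    have "eventually (\<lambda>x::real. False) (at 0)"
      using eq nz hnz by eventually_elim (simp add: \<open>p = 0\<close>)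
    then show False by simp
  qed
  define m where "m = Polynomial.order 0 p"
  obtain q where q: "p = [:- 0, 1:] ^ m * q" and ndvd: "\<not> [:- 0, 1:] dvd q"
    using order_decomp[OF p, of 0] unfolding m_def by blast
  have q0: "poly q 0 \<noteq> 0" using ndvd poly_eq_0_iff_dvd[of q 0] by simp
  have qlim: "(poly q \<longlongrightarrow> poly q 0) (at 0)"
    by (intro tendsto_intros)
  have eq': "eventually (\<lambda>x. x ^ (m + a) * poly q x = x ^ b * h x) (at 0)"
    using eq by eventually_elim (simp add: q power_add mult_ac)
  have pow0: "((\<lambda>x::real. x ^ d) \<longlongrightarrow> 0) (at 0)" if "d > 0" for d
    using tendsto_power[OF tendsto_ident_at[of "0::real" UNIV], of d] that by simp
  show "m + a = b"
  proof (rule ccontr)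
    assume "m + a \<noteq> b"
    \<comment> \<open>Cancelling the smaller power of \<open>x\<close> leaves \<open>x ^ d\<close>
      with \<open>d > 0\<close> on one side, so the limit on the other side, \<open>l\<close> or
      \<open>poly q 0\<close>, would be 0.\<close>
    then consider d where "m + a = b + d" "d > 0" | d where "b = m + a + d" "d > 0"
      by (metis less_imp_add_positive linorder_neqE_nat)
    then show False
    proof cases
      case 1
      have "eventually (\<lambda>x. x ^ d * poly q x = h x) (at 0)"
        using eq' nz by eventually_elim (simp add: 1 power_add)
      then have "(h \<longlongrightarrow> 0 * poly q 0) (at 0)"
        using tendsto_cong tendsto_mult[OF pow0[OF 1(2)] qlim] by fastforce
      with lim l show False using tendsto_unique[of "at (0::real)" h] by auto
    next
      case 2
      have "eventually (\<lambda>x. x ^ d * h x = poly q x) (at 0)"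
        using eq' nz by eventually_elim (simp add: 2 power_add)
      then have "(poly q \<longlongrightarrow> 0 * l) (at 0)"
        using tendsto_cong tendsto_mult[OF pow0[OF 2(2)] lim] by fastforce
      with qlim q0 show False using tendsto_unique[of "at (0::real)" "poly q"] by auto
    qed
  qed
qed

lemma card_disjoint_pairs_le:
  assumes fin: "finite W" and M: "\<And>e. e \<in> M \<Longrightarrow> e \<subseteq> W \<and> card e = 2"
    and disj: "\<And>e f. e \<in> M \<Longrightarrow> f \<in> M \<Longrightarrow> e \<noteq> f \<Longrightarrow> e \<inter> f = {}"
  shows "2 * card M \<le> card W"
proof -
  have "finite M" using M fin by (auto intro: finite_subset[of M "Pow W"])
  have "card (\<Union>M) = (\<Sum>e\<in>M. card e)"
    by (rule card_Union_disjoint) (use M disj in \<open>auto simp: pairwise_def disjnt_def intro: card_ge_0_finite\<close>)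
  also have "\<dots> = 2 * card M" using M by simp
  finally show ?thesis using card_mono[OF fin, of "\<Union>M"] M by fastforce
qed

subsection \<open>Bouquets of blocks\<close>

datatype block = Leaves | Triangle | Balanced_Square | Unbalanced_Square

text \<open>Vertex 0 is the centre; a block with offset \<open>k\<close> has the vertices \<open>k + 1, \<dots>, k + 4\<close>.\<close>

fun block_edges :: "block \<Rightarrow> nat \<Rightarrow> nat set set" where
  "block_edges Leaves k = {{0, k + 1}, {0, k + 2}, {0, k + 3}, {0, k + 4}}"
| "block_edges Triangle k =
     {{0, k + 1}, {0, k + 4}, {k + 1, k + 2}, {k + 2, k + 3}, {k + 1, k + 3}}"
| "block_edges _ k =
     {{0, k + 1}, {k + 1, k + 2}, {k + 2, k + 3}, {k + 3, k + 4}, {k + 1, k + 4}}"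

text \<open>A single negative edge makes the sign product around the 4-cycle negative, that is, the
  cycle unbalanced.\<close>

fun block_negative_edges :: "block \<Rightarrow> nat \<Rightarrow> nat set set" where
  "block_negative_edges Unbalanced_Square k = {{k + 1, k + 4}}"
| "block_negative_edges _ k = {}"

text \<open>The head of the list gets the largest offset, so consing a block keeps all earlier
  labels and puts its four rows last in the matrix. The last block of a list has offset 0.\<close>

fun bouquet_edges :: "block list \<Rightarrow> nat set set" where
  "bouquet_edges [] = {}"
| "bouquet_edges (t # ts) = block_edges t (4 * length ts) \<union> bouquet_edges ts"

fun bouquet_negative_edges :: "block list \<Rightarrow> nat set set" where
  "bouquet_negative_edges [] = {}"
| "bouquet_negative_edges (t # ts) =
     block_negative_edges t (4 * length ts) \<union> bouquet_negative_edges ts"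

definition bouquet :: "block list \<Rightarrow> nat signed_graph" where
  "bouquet ts = \<lparr>sg_verts = {..4 * length ts}, sg_edges = bouquet_edges ts,
     sg_sign = (\<lambda>e. if e \<in> bouquet_negative_edges ts then - 1 else 1)\<rparr>"

lemma bouquet_simps [simp]:
  "sg_verts (bouquet ts) = {..4 * length ts}"
  "sg_edges (bouquet ts) = bouquet_edges ts"
  "sg_sign (bouquet ts) e = (if e \<in> bouquet_negative_edges ts then - 1 else 1)"
  by (simp_all add: bouquet_def)

text \<open>The vertex above \<open>k\<close> is what distinguishes an edge of this block from the
  edges of all blocks with smaller offset.\<close>

lemma block_edges_wf:
  "e \<in> block_edges t k \<Longrightarrow> card e = 2 \<and> e \<subseteq> {..k + 4} \<and> (\<exists>v \<in> e. k < v)"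
  by (cases t) auto

lemma block_negative_edges_subset: "block_negative_edges t k \<subseteq> block_edges t k"
  by (cases t) auto

lemma bouquet_edges_wf:
  "e \<in> bouquet_edges ts \<Longrightarrow> card e = 2 \<and> e \<subseteq> {..4 * length ts}"
proof (induction ts)
  case (Cons t ts)
  then consider "e \<in> block_edges t (4 * length ts)" | "e \<in> bouquet_edges ts" by auto
  then show ?case
  proof cases
    case 1
    then show ?thesis using block_edges_wf[OF 1] by (auto simp: add.commute)
  next
    case 2
    then show ?thesis using Cons.IH by fastforce
  qed
qed simp

lemma bouquet_negative_edges_subset: "bouquet_negative_edges ts \<subseteq> bouquet_edges ts"
  by (induction ts) (use block_negative_edges_subset in \<open>auto simp: subset_iff\<close>)

lemma bouquet_edges_disjoint:
  "block_edges t (4 * length ts) \<inter> bouquet_edges ts = {}"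
  using block_edges_wf[of _ t "4 * length ts"] bouquet_edges_wf[of _ ts] by fastforce

lemma is_signed_graph_bouquet: "is_signed_graph (bouquet ts)"
  using bouquet_edges_wf[of _ ts] by (auto simp: is_signed_graph_def)

lemma finite_bouquet_edges: "finite (bouquet_edges ts)"
  by (rule finite_subset[of _ "Pow {..4 * length ts}"]) (use bouquet_edges_wf in auto)

subsection \<open>Connectedness and cyclomatic number\<close>

lemma sym_sg_adj: "sym (sg_adj G)"
  by (auto simp: sym_def sg_adj_def insert_commute)

lemma bouquet_reaches_centre:
  "v \<le> 4 * length ts \<Longrightarrow> (v, 0) \<in> (sg_adj (bouquet ts))\<^sup>*"
proof (induction ts)
  case Nil
  then show ?case by simp
next
  case (Cons t ts)
  let ?R = "sg_adj (bouquet (t # ts))" and ?k = "4 * length ts"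
  have sub: "sg_adj (bouquet ts) \<subseteq> ?R" by (auto simp: sg_adj_def)
  have edge: "(u, v) \<in> ?R" if "{u, v} \<in> block_edges t ?k" for u v
    using that by (auto simp: sg_adj_def)
  show ?case
  proof (cases "v \<le> ?k")
    case True
    then show ?thesis using Cons.IH rtrancl_mono[OF sub] by blast
  next
    case False
    then have "v = ?k + 1 \<or> v = ?k + 2 \<or> v = ?k + 3 \<or> v = ?k + 4" using Cons.prems by auto
    \<comment> \<open>In every block \<open>?k + 1\<close> is adjacent to the centre. Each other
      vertex is adjacent to the centre too, or leads to an earlier one: \<open>?k + 2\<close> and
      \<open>?k + 4\<close> to \<open>?k + 1\<close>, and \<open>?k + 3\<close> to
      \<open>?k + 2\<close>.\<close>
    moreover have 1: "(?k + 1, 0) \<in> ?R\<^sup>*"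
      by (rule r_into_rtrancl, rule edge) (cases t; simp add: doubleton_eq_iff)
    moreover have 2: "(?k + 2, 0) \<in> ?R\<^sup>*"
    proof (cases "t = Leaves")
      case True
      then show ?thesis by (intro r_into_rtrancl edge) (auto simp: doubleton_eq_iff)
    next
      case False
      then have "(?k + 2, ?k + 1) \<in> ?R" by (intro edge) (cases t; simp add: doubleton_eq_iff)
      then show ?thesis using 1 by (rule converse_rtrancl_into_rtrancl)
    qed
    moreover have "(?k + 3, 0) \<in> ?R\<^sup>*"
    proof (cases "t = Leaves")
      case True
      then show ?thesis by (intro r_into_rtrancl edge) (auto simp: doubleton_eq_iff)
    next
      case False
      then have "(?k + 3, ?k + 2) \<in> ?R" by (intro edge) (cases t; simp add: doubleton_eq_iff)
      then show ?thesis using 2 by (rule converse_rtrancl_into_rtrancl)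
    qed
    moreover have "(?k + 4, 0) \<in> ?R\<^sup>*"
    proof (cases "t = Leaves \<or> t = Triangle")
      case True
      then show ?thesis by (intro r_into_rtrancl edge) (auto simp: doubleton_eq_iff)
    next
      case False
      then have "(?k + 4, ?k + 1) \<in> ?R" by (intro edge) (cases t; simp add: doubleton_eq_iff)
      then show ?thesis using 1 by (rule converse_rtrancl_into_rtrancl)
    qed
    ultimately show ?thesis by blast
  qed
qed

lemma sg_connected_bouquet: "sg_connected (bouquet ts)"
  unfolding sg_connected_def
proof (intro conjI ballI)
  show "sg_verts (bouquet ts) \<noteq> {}" by auto
  fix u v assume "u \<in> sg_verts (bouquet ts)" "v \<in> sg_verts (bouquet ts)"
  then have "(u, 0) \<in> (sg_adj (bouquet ts))\<^sup>*" "(v, 0) \<in> (sg_adj (bouquet ts))\<^sup>*"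
    by (auto intro: bouquet_reaches_centre)
  then show "(u, v) \<in> (sg_adj (bouquet ts))\<^sup>*"
    using sym_rtrancl[OF sym_sg_adj] by (meson rtrancl_trans symD)
qed

lemma sg_components_connected:
  assumes "sg_connected G"
  shows "sg_components G = {sg_verts G}"
proof -
  have "(sg_adj G)\<^sup>* \<inter> sg_verts G \<times> sg_verts G = sg_verts G \<times> sg_verts G"
    using assms by (auto simp: sg_connected_def)
  then show ?thesis
    using assms by (auto simp: sg_components_def sg_connected_def quotient_def)
qed

text \<open>Attaching four vertices connectedly costs four edges; a fifth edge closes exactly one
  cycle. Hence the cyclomatic number will count the blocks other than \<open>Leaves\<close>.\<close>

lemma card_block_edges: "card (block_edges t k) = 4 + of_bool (t \<noteq> Leaves)"
  by (cases t) (simp_all add: card_insert_if doubleton_eq_iff)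

lemma card_bouquet_edges:
  "card (bouquet_edges ts) = 4 * length ts + (\<Sum>t\<leftarrow>ts. of_bool (t \<noteq> Leaves))"
proof (induction ts)
  case (Cons t ts)
  have "finite (block_edges t (4 * length ts))" by (cases t) auto
  then show ?case
    by (simp add: card_Un_disjoint bouquet_edges_disjoint finite_bouquet_edges card_block_edges
        Cons.IH)
qed simp

lemma cyclomatic_number_bouquet:
  "cyclomatic_number (bouquet ts) = int (\<Sum>t\<leftarrow>ts. of_bool (t \<noteq> Leaves))"
  using sg_components_connected[OF sg_connected_bouquet, of ts]
  by (simp add: cyclomatic_number_def card_bouquet_edges)

subsection \<open>Matching number\<close>

text \<open>Maximum matchings of the blocks with the centre deleted; the centre stays free for an
  edge to a leaf.\<close>

fun block_matching :: "block \<Rightarrow> nat \<Rightarrow> nat set set" where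
  "block_matching Leaves k = {}"
| "block_matching Triangle k = {{k + 1, k + 2}}"
| "block_matching _ k = {{k + 1, k + 2}, {k + 3, k + 4}}"

fun block_matching_number :: "block \<Rightarrow> nat" where
  "block_matching_number Leaves = 0"
| "block_matching_number Triangle = 1"
| "block_matching_number _ = 2"

lemma finite_sg_matchings: "finite (sg_edges G) \<Longrightarrow> finite {M. sg_matching G M}"
  by (rule finite_subset[of _ "Pow (sg_edges G)"]) (auto simp: sg_matching_def)

lemma matching_number_eqI:
  assumes "finite (sg_edges G)" and "sg_matching G M"
    and "\<And>M'. sg_matching G M' \<Longrightarrow> card M' \<le> card M"
  shows "matching_number G = card M"
  unfolding matching_number_def
  by (rule Max_eqI) (use assms finite_sg_matchings in auto)

lemma sg_matching_subset: "sg_matching G M \<Longrightarrow> N \<subseteq> M \<Longrightarrow> sg_matching G N"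
  unfolding sg_matching_def by blast

lemma card_block_matching_le:
  assumes "M \<subseteq> block_edges t k" and "\<And>e f. e \<in> M \<Longrightarrow> f \<in> M \<Longrightarrow> e \<noteq> f \<Longrightarrow> e \<inter> f = {}"
    and "0 \<notin> \<Union>M"
  shows "card M \<le> block_matching_number t"
proof -
  \<comment> \<open>Once the centre is deleted, only the first \<open>r\<close> vertices of the
    block lie on an edge: the leaf of the triangle block and all four vertices of
    \<open>Leaves\<close> become isolated.\<close>
  define r where "r = (case t of Leaves \<Rightarrow> 0 :: nat | Triangle \<Rightarrow> 3 | _ \<Rightarrow> 4)"
  have "2 * card M \<le> card {k + 1..k + r}"
  proof (rule card_disjoint_pairs_le)
    fix e assume e: "e \<in> M"
    then have "e \<in> block_edges t k" "0 \<notin> e" using assms by auto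
    then show "e \<subseteq> {k + 1..k + r} \<and> card e = 2" by (cases t) (auto simp: r_def)
  qed (use assms in auto)
  then show ?thesis by (cases t) (auto simp: r_def)
qed

lemma card_bouquet_matching_avoiding_centre_le:
  "\<lbrakk>sg_matching (bouquet ts) M; 0 \<notin> \<Union>M\<rbrakk> \<Longrightarrow> card M \<le> (\<Sum>t\<leftarrow>ts. block_matching_number t)"
proof (induction ts arbitrary: M)
  case Nil
  then show ?case by (auto simp: sg_matching_def)
next
  case (Cons t ts)
  let ?B = "block_edges t (4 * length ts)" and ?E = "bouquet_edges ts"
  have M: "M \<subseteq> ?B \<union> ?E" using Cons.prems by (auto simp: sg_matching_def)
  then have "M = (M \<inter> ?B) \<union> (M \<inter> ?E)" by auto
  then have "card M \<le> card (M \<inter> ?B) + card (M \<inter> ?E)" by (metis card_Un_le)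
  moreover have "card (M \<inter> ?B) \<le> block_matching_number t"
    by (rule card_block_matching_le) (use Cons.prems in \<open>auto simp: sg_matching_def\<close>)
  moreover have "card (M \<inter> ?E) \<le> (\<Sum>t\<leftarrow>ts. block_matching_number t)"
    by (rule Cons.IH) (use Cons.prems in \<open>auto simp: sg_matching_def\<close>)
  ultimately show ?case by simp
qed

text \<open>At most one matching edge contains the centre, and the remaining edges split among the
  blocks.\<close>

lemma card_bouquet_matching_le:
  assumes "sg_matching (bouquet ts) M"
  shows "card M \<le> Suc (\<Sum>t\<leftarrow>ts. block_matching_number t)"
proof -
  let ?C = "{e \<in> M. 0 \<in> e}"
  have "finite M"
    using assms finite_bouquet_edges[of ts] by (auto simp: sg_matching_def intro: finite_subset)
  have "e = f" if "e \<in> ?C" "f \<in> ?C" for e f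
    using that assms by (auto simp: sg_matching_def)
  then have "card ?C \<le> 1" using card_le_Suc0_iff_eq[of ?C] \<open>finite M\<close> by auto
  moreover have "card (M - ?C) \<le> (\<Sum>t\<leftarrow>ts. block_matching_number t)"
    by (rule card_bouquet_matching_avoiding_centre_le[OF sg_matching_subset[OF assms]]) auto
  moreover have "card M = card ?C + card (M - ?C)"
    using \<open>finite M\<close> by (simp add: card_Diff_subset card_mono)
  ultimately show ?thesis by simp
qed

lemma sg_matching_Un:
  assumes "sg_matching G M" and "sg_matching G N" and "\<Union>M \<inter> \<Union>N = {}"
  shows "sg_matching G (M \<union> N)"
  unfolding sg_matching_def
proof (intro conjI ballI impI)
  show "M \<union> N \<subseteq> sg_edges G" using assms(1,2) by (simp add: sg_matching_def)
  have mixed: "e \<inter> f = {}" if "e \<in> M" "f \<in> N" for e f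
    using assms(3) Union_upper[OF that(1)] Union_upper[OF that(2)] by fast
  fix e f assume "e \<in> M \<union> N" "f \<in> M \<union> N" "e \<noteq> f"
  then show "e \<inter> f = {}"
    using assms(1,2) mixed unfolding sg_matching_def by (metis Un_iff inf_commute)
qed

text \<open>The final \<open>Leaves\<close> has offset 0, so vertex 1 is a leaf; 0 and 1 are left
  uncovered so that \<open>{0, 1}\<close> can be added later. The upper bound on the covered
  vertices gives disjointness from the next block in the induction.\<close>

lemma exists_bouquet_matching:
  "\<exists>M. sg_matching (bouquet (ts @ [Leaves])) M \<and> \<Union>M \<inter> {0, 1} = {} \<and>
     \<Union>M \<subseteq> {..4 * length (ts @ [Leaves])} \<and>
     card M = (\<Sum>t\<leftarrow>ts. block_matching_number t)"
proof (induction ts)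
  case Nil
  show ?case by (intro exI[of _ "{}"]) (auto simp: sg_matching_def)
next
  case (Cons t ts)
  let ?k = "4 * length (ts @ [Leaves])"
  obtain M where M: "sg_matching (bouquet (ts @ [Leaves])) M" "\<Union>M \<inter> {0, 1} = {}"
    "\<Union>M \<subseteq> {..?k}" "card M = (\<Sum>t\<leftarrow>ts. block_matching_number t)"
    using Cons.IH by blast
  define N where "N = block_matching t ?k"
  have N: "\<Union>N \<subseteq> {?k + 1..?k + 4}" "finite N" "{} \<notin> N"
    unfolding N_def by (cases t; simp)+
  have cardN: "card N = block_matching_number t"
    unfolding N_def by (cases t) (simp_all add: doubleton_eq_iff)
  have matchN: "sg_matching (bouquet (t # ts @ [Leaves])) N"
    unfolding N_def by (cases t) (auto simp: sg_matching_def)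
  have disj: "\<Union>M \<inter> \<Union>N = {}" using M(3) N(1) by fastforce
  have "sg_matching (bouquet (t # ts @ [Leaves])) M"
    using M(1) by (auto simp: sg_matching_def)
  then have "sg_matching (bouquet (t # ts @ [Leaves])) (M \<union> N)"
    using matchN disj by (rule sg_matching_Un)
  moreover have "card (M \<union> N) = card M + card N"
  proof (rule card_Un_disjoint)
    show "finite M"
      using M(1) finite_bouquet_edges[of "ts @ [Leaves]"]
      by (auto simp: sg_matching_def intro: finite_subset)
    show "M \<inter> N = {}"
    proof (rule equals0I)
      fix e assume e: "e \<in> M \<inter> N"
      then have "e \<subseteq> \<Union>M \<inter> \<Union>N" by blast
      with disj e N(3) show False by simp
    qed
  qed (fact N(2))
  moreover have "\<Union>(M \<union> N) \<inter> {0, 1} = {}" using M(2) N(1) by fastforce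
  moreover have "\<Union>(M \<union> N) \<subseteq> {..4 * length ((t # ts) @ [Leaves])}"
    using M(3) N(1) by fastforce
  ultimately show ?case using M(4) cardN by (intro exI[of _ "M \<union> N"]) simp
qed

lemma block_edges_subset_bouquet: "block_edges t 0 \<subseteq> bouquet_edges (ts @ [t])"
  by (induction ts) auto

lemma matching_number_bouquet:
  "matching_number (bouquet (ts @ [Leaves])) = Suc (\<Sum>t\<leftarrow>ts. block_matching_number t)"
proof -
  let ?G = "bouquet (ts @ [Leaves])"
  obtain M where M: "sg_matching ?G M" "\<Union>M \<inter> {0, 1} = {}"
    "card M = (\<Sum>t\<leftarrow>ts. block_matching_number t)"
    using exists_bouquet_matching[of ts] by (elim exE conjE) (rule that)
  have "{0, 1} \<in> block_edges Leaves 0" by simp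
  then have "{0, 1} \<in> bouquet_edges (ts @ [Leaves])" using block_edges_subset_bouquet by blast
  then have "sg_matching ?G {{0, 1}}" by (simp add: sg_matching_def)
  then have match: "sg_matching ?G ({{0, 1}} \<union> M)"
    by (rule sg_matching_Un) (use M in auto)
  have "finite M"
    using M(1) finite_bouquet_edges[of "ts @ [Leaves]"]
    by (auto simp: sg_matching_def intro: finite_subset)
  then have card: "card ({{0, 1}} \<union> M) = Suc (\<Sum>t\<leftarrow>ts. block_matching_number t)"
    using M by (auto simp: card_insert_if)
  have "matching_number ?G = card ({{0, 1}} \<union> M)"
    by (rule matching_number_eqI[OF _ match])
      (use card_bouquet_matching_le[of "ts @ [Leaves]"] card finite_bouquet_edges in auto)
  with card show ?thesis by simp
qed

subsection \<open>Nullity\<close>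

text \<open>Laplace expansion along the first row. Writing the minors again as explicit
  \<open>Matrix.mat\<close> terms lets small determinants be evaluated by repeated
  rewriting.\<close>

lemma det_mat_Suc:
  "det (Matrix.mat (Suc n) (Suc n) f) = (\<Sum>j<Suc n. f (0, j) * ((- 1) ^ j *
     det (Matrix.mat n n (\<lambda>(i, l). f (Suc i, if l < j then l else Suc l)))))"
  (is "det ?A = _")
proof -
  have "det ?A = (\<Sum>j<Suc n. ?A $$ (0, j) * cofactor ?A 0 j)"
    by (rule laplace_expansion_row) auto
  also have "\<dots> = (\<Sum>j<Suc n. f (0, j) * ((- 1) ^ j *
     det (Matrix.mat n n (\<lambda>(i, l). f (Suc i, if l < j then l else Suc l)))))"
  proof (rule sum.cong[OF refl])
    fix j assume "j \<in> {..<Suc n}"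
    then have "mat_delete ?A 0 j = Matrix.mat n n (\<lambda>(i, l). f (Suc i, if l < j then l else Suc l))"
      by (intro eq_matI) (auto simp: mat_delete_def)
    with \<open>j \<in> _\<close> show "?A $$ (0, j) * cofactor ?A 0 j = f (0, j) * ((- 1) ^ j *
      det (Matrix.mat n n (\<lambda>(i, l). f (Suc i, if l < j then l else Suc l))))"
      by (simp add: cofactor_def)
  qed
  finally show ?thesis .
qed

section \<open>Explicit linear algebra of the four blocks\<close>

definition block_weight :: "block \<Rightarrow> nat \<Rightarrow> nat set \<Rightarrow> real" where
  "block_weight t k e =
     (if e \<in> block_edges t k then if e \<in> block_negative_edges t k then - 1 else 1 else 0)"

definition bouquet_weight :: "block list \<Rightarrow> nat set \<Rightarrow> real" where
  "bouquet_weight ts e =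
     (if e \<in> bouquet_edges ts then if e \<in> bouquet_negative_edges ts then - 1 else 1 else 0)"

text \<open>Index \<open>p\<close> stands for vertex \<open>k + 1 + p\<close>. The squares are the
  cycle 0, 1, 2, 3, whose edges are the pairs with odd sum; \<open>p + q = 3\<close> with
  \<open>p * q = 0\<close> singles out the closing pair 0, 3, which carries the negative
  sign.\<close>

fun block_entry :: "block \<Rightarrow> nat \<Rightarrow> nat \<Rightarrow> real" where
  "block_entry Leaves p q = 0"
| "block_entry Triangle p q = (if p = q \<or> p = 3 \<or> q = 3 then 0 else 1)"
| "block_entry Balanced_Square p q = (if even (p + q) then 0 else 1)"
| "block_entry Unbalanced_Square p q =
     (if even (p + q) then 0 else if p + q = 3 \<and> p * q = 0 then - 1 else 1)"

fun block_star :: "block \<Rightarrow> nat \<Rightarrow> real" where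
  "block_star Leaves q = 1"
| "block_star Triangle q = (if q = 0 \<or> q = 3 then 1 else 0)"
| "block_star _ q = (if q = 0 then 1 else 0)"

definition block_char_mat :: "block \<Rightarrow> real \<Rightarrow> real mat" where
  "block_char_mat t x =
     Matrix.mat 4 4 (\<lambda>(p, q). if p = q then x else - block_entry t p q)"

text \<open>
  The diagonal entry at the centre is a separate parameter, since eliminating a block changes it.
\<close>

definition bouquet_char_mat :: "block list \<Rightarrow> real \<Rightarrow> real \<Rightarrow> real mat" where
  "bouquet_char_mat ts a x = Matrix.mat (4 * length ts + 1) (4 * length ts + 1)
     (\<lambda>(i, j). if i = j then if i = 0 then a else x else - bouquet_weight ts {i, j})"

text \<open>
  \<open>response t x\<close> solves \<open>(x I - B) y = b\<close>, where \<open>B\<close> has the entries \<open>block_entry t\<close> and \<open>b\<close> is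
  \<open>block_star t\<close>, and \<open>coupling t x / x\<close> is \<open>b \<bullet> y\<close>.
\<close>

fun response :: "block \<Rightarrow> real \<Rightarrow> nat \<Rightarrow> real" where
  "response Leaves x q = 1 / x"
| "response Triangle x q = (if q = 0 then (x - 1) / ((x - 2) * (x + 1))
     else if q = 3 then 1 / x else 1 / ((x - 2) * (x + 1)))"
| "response Balanced_Square x q = (if q = 0 then (x\<^sup>2 - 2) / (x * (x\<^sup>2 - 4))
     else if q = 2 then 2 / (x * (x\<^sup>2 - 4)) else 1 / (x\<^sup>2 - 4))"
| "response Unbalanced_Square x q = (if q = 0 then x / (x\<^sup>2 - 2)
     else if q = 1 then 1 / (x\<^sup>2 - 2) else if q = 2 then 0 else - 1 / (x\<^sup>2 - 2))"

fun coupling :: "block \<Rightarrow> real \<Rightarrow> real" where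
  "coupling Leaves x = 4"
| "coupling Triangle x = 1 + x * (x - 1) / ((x - 2) * (x + 1))"
| "coupling Balanced_Square x = (x\<^sup>2 - 2) / (x\<^sup>2 - 4)"
| "coupling Unbalanced_Square x = x\<^sup>2 / (x\<^sup>2 - 2)"

fun block_nullity :: "block \<Rightarrow> nat" where
  "block_nullity Leaves = 4"
| "block_nullity Triangle = 1"
| "block_nullity Balanced_Square = 2"
| "block_nullity Unbalanced_Square = 0"

text \<open>The block's characteristic polynomial with its power of \<open>x\<close> removed. It
  does not vanish at 0, so \<open>block_nullity\<close> is the exact multiplicity of the eigenvalue
  0.\<close>

fun block_cofactor :: "block \<Rightarrow> real \<Rightarrow> real" where
  "block_cofactor Leaves x = 1"
| "block_cofactor Triangle x = (x - 2) * (x + 1)\<^sup>2"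
| "block_cofactor Balanced_Square x = x\<^sup>2 - 4"
| "block_cofactor Unbalanced_Square x = (x\<^sup>2 - 2)\<^sup>2"

text \<open>The nonzero block eigenvalues are 2, -2, -1 and plus or minus the square root of 2. All
  have modulus at least 1, so the denominators in \<open>response\<close> and
  \<open>coupling\<close> are nonzero for these \<open>x\<close>.\<close>

lemma small_nonzero:
  fixes x :: real
  assumes "x \<noteq> 0" and "\<bar>x\<bar> < 1"
  shows "x - 2 \<noteq> 0" "x + 1 \<noteq> 0" "x\<^sup>2 - 4 \<noteq> 0" "x\<^sup>2 - 2 \<noteq> 0"
proof -
  have "x\<^sup>2 < 1" using assms by (simp add: abs_square_less_1)
  then show "x - 2 \<noteq> 0" "x + 1 \<noteq> 0" "x\<^sup>2 - 4 \<noteq> 0" "x\<^sup>2 - 2 \<noteq> 0" using assms by auto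
qed

lemma nat_less_4_iff: "p < 4 \<longleftrightarrow> p = 0 \<or> p = 1 \<or> p = 2 \<or> p = (3 :: nat)"
  by auto

lemma sum_lessThan_4: "(\<Sum>q<4. f q) = f 0 + f 1 + f 2 + f (3 :: nat)"
  by (simp add: eval_nat_numeral)

lemma response_solves:
  assumes "x \<noteq> 0" and "\<bar>x\<bar> < 1" and "p < 4"
  shows "(\<Sum>q<4. (if p = q then x else - block_entry t p q) * response t x q) =
    block_star t p"
proof -
  note nz = assms(1) small_nonzero[OF assms(1,2)]
  consider "p = 0" | "p = 1" | "p = 2" | "p = 3" using assms(3) by linarith
  then show ?thesis
  proof cases
    case 1
    then show ?thesis unfolding sum_lessThan_4 using nz
      by (cases t) (simp_all add: divide_simps, simp_all add: algebra_simps power2_eq_square)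
  next
    case 2
    then show ?thesis unfolding sum_lessThan_4 using nz
      by (cases t) (simp_all add: divide_simps power2_eq_square)
  next
    case 3
    then show ?thesis unfolding sum_lessThan_4 using nz
      by (cases t) (simp_all add: divide_simps power2_eq_square)
  next
    case 4
    then show ?thesis unfolding sum_lessThan_4 using nz
      by (cases t) (simp_all add: divide_simps, simp_all add: algebra_simps power2_eq_square)
  qed
qed

lemma coupling_eq:
  assumes "x \<noteq> 0" and "\<bar>x\<bar> < 1"
  shows "(\<Sum>q<4. block_star t q * response t x q) = coupling t x / x"
  using assms(1) small_nonzero[OF assms] unfolding sum_lessThan_4
  by (cases t) (simp_all add: divide_simps power2_eq_square)

lemma det_mat_2: "det (Matrix.mat 2 2 f) = f (0,0) * f (1,1) - f (0,1) * f (1,0)"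
  unfolding numeral_2_eq_2 det_mat_Suc by simp

lemma det_mat_3: "det (Matrix.mat 3 3 f) = f (0,0) * (f (1,1) * f (2,2) - f (1,2) * f (2,1))
  - f (0,1) * (f (1,0) * f (2,2) - f (1,2) * f (2,0)) + f (0,2) * (f (1,0) * f (2,1) - f (1,1) * f (2,0))"
  unfolding numeral_3_eq_3 det_mat_Suc[of 2, unfolded numeral_2_eq_2] det_mat_2[unfolded numeral_2_eq_2]
  by (simp add: numeral_2_eq_2 algebra_simps)

lemma det_mat_4: "det (Matrix.mat 4 4 f) = (\<Sum>j<4. f (0, j) * ((- 1) ^ j *
     det (Matrix.mat 3 3 (\<lambda>(i, l). f (Suc i, if l < j then l else Suc l)))))"
  using det_mat_Suc[of 3 f] by simp

lemma det_block_char_mat: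
  "det (block_char_mat t x) = x ^ block_nullity t * block_cofactor t x"
  unfolding block_char_mat_def det_mat_4 det_mat_3 sum_lessThan_4
  by (cases t; simp; simp add: algebra_simps power2_eq_square power4_eq_xxxx)

section \<open>Eliminating blocks from the characteristic matrix\<close>

lemma bouquet_weight_old:
  assumes "e \<subseteq> {..4 * length ts}"
  shows "bouquet_weight (t # ts) e = bouquet_weight ts e"
proof -
  have "e \<notin> block_edges t (4 * length ts)" using assms block_edges_wf by fastforce
  then show ?thesis using block_negative_edges_subset by (auto simp: bouquet_weight_def)
qed

lemma bouquet_weight_new:
  assumes "\<not> e \<subseteq> {..4 * length ts}"
  shows "bouquet_weight (t # ts) e = block_weight t (4 * length ts) e"
proof -
  have "e \<notin> bouquet_edges ts" using assms bouquet_edges_wf by blast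
  then show ?thesis
    using bouquet_negative_edges_subset by (auto simp: bouquet_weight_def block_weight_def)
qed

lemma block_weight_base:
  assumes "p < 4" and "q < 4"
  shows "block_weight t 0 {p + 1, q + 1} = block_entry t p q"
proof -
  consider "p = 0" | "p = 1" | "p = 2" | "p = 3" using assms by linarith
  then show ?thesis
  proof cases
    case 1
    then show ?thesis using assms(2) unfolding nat_less_4_iff
      by (cases t) (auto simp: block_weight_def doubleton_eq_iff)
  next
    case 2
    then show ?thesis using assms(2) unfolding nat_less_4_iff
      by (cases t) (auto simp: block_weight_def doubleton_eq_iff)
  next
    case 3
    then show ?thesis using assms(2) unfolding nat_less_4_iff
      by (cases t) (auto simp: block_weight_def doubleton_eq_iff)
  next
    case 4
    then show ?thesis using assms(2) unfolding nat_less_4_iff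
      by (cases t) (auto simp: block_weight_def doubleton_eq_iff)
  qed
qed

text \<open>Weights inside a block are invariant under translation, which reduces them to offset 0,
  where all labels are numerals.\<close>

lemma block_weight_shift:
  assumes "p < 4" and "q < 4"
  shows "block_weight t k {k + 1 + p, k + 1 + q} = block_entry t p q"
proof -
  have "block_weight t k {k + 1 + p, k + 1 + q} = block_weight t 0 {p + 1, q + 1}"
    by (cases t) (auto simp: block_weight_def doubleton_eq_iff)
  with block_weight_base[OF assms] show ?thesis by simp
qed

lemma block_weight_centre:
  assumes "i \<le> k" and "q < 4"
  shows "block_weight t k {i, k + 1 + q} = (if i = 0 then block_star t q else 0)"
  using assms unfolding nat_less_4_iff
  by (cases t) (auto simp: block_weight_def doubleton_eq_iff)

text \<open>A block meets the rest of the graph only at the centre, so \<open>B\<close> has a single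
  nonzero row and \<open>Z\<close> a single nonzero column. The Schur complement therefore changes
  only the entry at (0, 0).\<close>

lemma det_bouquet_char_mat_Cons:
  assumes "x \<noteq> 0" and "\<bar>x\<bar> < 1"
  shows "det (bouquet_char_mat (t # ts) a x) =
    det (bouquet_char_mat ts (a - coupling t x / x) x) * det (block_char_mat t x)"
proof -
  define k where "k = 4 * length ts"
  define B where "B = Matrix.mat (k + 1) 4
    (\<lambda>(i, q). if i = 0 then - block_star t q else 0)"
  \<comment> \<open>The lower left block has \<open>- block_star t\<close> as its centre column and
    zeros elsewhere, hence the minus sign. It cancels against the one in \<open>B\<close>, so the
    centre entry of \<open>B * Z\<close> is \<open>coupling t x / x\<close>.\<close>
  define Z where "Z = Matrix.mat 4 (k + 1) (\<lambda>(p, j). if j = 0 then - response t x p else 0)"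
  let ?A = "bouquet_char_mat ts a x" and ?D = "block_char_mat t x"
  have carrier: "?A \<in> carrier_mat (k + 1) (k + 1)" "B \<in> carrier_mat (k + 1) 4"
    "?D \<in> carrier_mat 4 4" "Z \<in> carrier_mat 4 (k + 1)"
    by (simp_all add: bouquet_char_mat_def block_char_mat_def B_def Z_def k_def)
  have DZ: "?D * Z = Matrix.mat 4 (k + 1)
    (\<lambda>(p, j). if j = 0 then - block_star t p else 0)" (is "_ = ?C")
  proof (rule eq_matI)
    fix p j assume "p < dim_row ?C" "j < dim_col ?C"
    then have pj: "p < 4" "j < k + 1" by simp_all
    then have "(?D * Z) $$ (p, j) = (\<Sum>q<4. ?D $$ (p, q) * Z $$ (q, j))"
      using carrier by (simp add: scalar_prod_def lessThan_atLeast0)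
    also have "\<dots> = (\<Sum>q<4. (if p = q then x else - block_entry t p q) *
      (if j = 0 then - response t x q else 0))"
      using pj by (intro sum.cong) (auto simp: block_char_mat_def Z_def)
    also have "\<dots> = (if j = 0 then - block_star t p else 0)"
    proof (cases "j = 0")
      case True
      then show ?thesis using response_solves[OF assms pj(1), of t] by (simp add: sum_negf)
    qed simp
    finally show "(?D * Z) $$ (p, j) = ?C $$ (p, j)" using pj by simp
  qed (use carrier in auto)
  have BZ: "?A - B * Z = bouquet_char_mat ts (a - coupling t x / x) x" (is "_ = ?R")
  proof (rule eq_matI)
    fix i j assume "i < dim_row ?R" "j < dim_col ?R"
    then have ij: "i < k + 1" "j < k + 1" by (simp_all add: bouquet_char_mat_def k_def)
    then have "(B * Z) $$ (i, j) = (\<Sum>q<4. B $$ (i, q) * Z $$ (q, j))"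
      using carrier by (simp add: scalar_prod_def lessThan_atLeast0)
    also have "\<dots> = (\<Sum>q<4. (if i = 0 then - block_star t q else 0) *
      (if j = 0 then - response t x q else 0))"
      using ij by (intro sum.cong) (auto simp: B_def Z_def)
    also have "\<dots> = (if i = 0 \<and> j = 0 then coupling t x / x else 0)"
      using coupling_eq[OF assms, of t] by simp
    finally show "(?A - B * Z) $$ (i, j) = ?R $$ (i, j)"
      using ij carrier by (auto simp: bouquet_char_mat_def k_def)
  qed (use carrier in \<open>auto simp: bouquet_char_mat_def k_def\<close>)
  have "bouquet_char_mat (t # ts) a x = four_block_mat ?A B ?C ?D" (is "?L = ?F")
  proof (rule eq_matI)
    fix i j assume "i < dim_row ?F" "j < dim_col ?F"
    then have ij: "i < k + 5" "j < k + 5"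
      by (simp_all add: bouquet_char_mat_def block_char_mat_def k_def)
    have L: "?L $$ (i, j) =
      (if i = j then if i = 0 then a else x else - bouquet_weight (t # ts) {i, j})"
      using ij by (simp add: bouquet_char_mat_def k_def)
    have F: "?F $$ (i, j) = (if i < k + 1 then if j < k + 1 then ?A $$ (i, j) else B $$ (i, j - (k + 1))
      else if j < k + 1 then ?C $$ (i - (k + 1), j) else ?D $$ (i - (k + 1), j - (k + 1)))"
      using ij carrier by (subst index_mat_four_block) auto
    show "?L $$ (i, j) = ?F $$ (i, j)"
    proof (cases "i < k + 1"; cases "j < k + 1")
      assume "i < k + 1" "j < k + 1"
      then show ?thesis
        unfolding L F using bouquet_weight_old[of "{i, j}" ts t] by (simp add: bouquet_char_mat_def k_def)
    next
      assume i: "i < k + 1" and j: "\<not> j < k + 1"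
      obtain q where q: "j = k + 1 + q" "q < 4"
        by (rule that[of "j - (k + 1)"]) (use ij j in auto)
      then have "bouquet_weight (t # ts) {i, j} = block_weight t k {i, k + 1 + q}"
        by (simp add: bouquet_weight_new k_def)
      then show ?thesis
        unfolding L F using i q block_weight_centre[of i k q t] by (simp add: B_def)
    next
      assume i: "\<not> i < k + 1" and j: "j < k + 1"
      obtain p where p: "i = k + 1 + p" "p < 4"
        by (rule that[of "i - (k + 1)"]) (use ij i in auto)
      then have "bouquet_weight (t # ts) {i, j} = block_weight t k {j, k + 1 + p}"
        by (simp add: bouquet_weight_new k_def insert_commute)
      then show ?thesis
        unfolding L F using j p block_weight_centre[of j k p t] by simp
    next
      assume i: "\<not> i < k + 1" and j: "\<not> j < k + 1"
      obtain p where p: "i = k + 1 + p" "p < 4"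
        by (rule that[of "i - (k + 1)"]) (use ij i in auto)
      obtain q where q: "j = k + 1 + q" "q < 4"
        by (rule that[of "j - (k + 1)"]) (use ij j in auto)
      have "bouquet_weight (t # ts) {i, j} = block_weight t k {k + 1 + p, k + 1 + q}"
        by (simp add: bouquet_weight_new k_def p q)
      then show ?thesis
        unfolding L F using p q block_weight_shift[of p q t k] by (simp add: block_char_mat_def)
    qed
  qed (simp_all add: bouquet_char_mat_def block_char_mat_def k_def)
  then show ?thesis
    using det_four_block_mat_solve[OF carrier] by (simp add: DZ BZ)
qed

lemma det_bouquet_char_mat:
  assumes "x \<noteq> 0" and "\<bar>x\<bar> < 1"
  shows "det (bouquet_char_mat ts a x) =
    x ^ (\<Sum>t\<leftarrow>ts. block_nullity t) * (\<Prod>t\<leftarrow>ts. block_cofactor t x) *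
      (a - (\<Sum>t\<leftarrow>ts. coupling t x) / x)"
proof (induction ts arbitrary: a)
  case Nil
  have "det (bouquet_char_mat [] a x) = bouquet_char_mat [] a x $$ (0, 0)"
    by (rule det_single) (simp add: bouquet_char_mat_def)
  then show ?case by (simp add: bouquet_char_mat_def)
next
  case (Cons t ts)
  show ?case
    unfolding det_bouquet_char_mat_Cons[OF assms] Cons.IH det_block_char_mat
    by (simp add: power_add add_divide_distrib mult_ac diff_diff_add)
qed

section \<open>From determinants to the nullity\<close>

lemma sg_adj_matrix_bouquet:
  "sg_adj_matrix (bouquet ts) = Matrix.mat (4 * length ts + 1) (4 * length ts + 1)
     (\<lambda>(i, j). bouquet_weight ts {i, j})"
proof -
  \<comment> \<open>The vertices are an initial segment of the naturals, so each vertex is its own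
    matrix index.\<close>
  have "sorted_list_of_set {..4 * length ts} = [0..<4 * length ts + 1]"
    by (metis Suc_eq_plus1 atLeast0LessThan lessThan_Suc_atMost sorted_list_of_set_range)
  then show ?thesis
    by (auto simp: sg_adj_matrix_def bouquet_weight_def Let_def simp del: upt_Suc intro!: eq_matI)
qed

lemma bouquet_weight_singleton: "bouquet_weight ts {i} = 0"
  using bouquet_edges_wf[of "{i}" ts] by (auto simp: bouquet_weight_def)

lemma poly_char_poly_bouquet:
  "poly (char_poly (sg_adj_matrix (bouquet ts))) x = det (bouquet_char_mat ts x x)"
proof -
  let ?n = "4 * length ts + 1"
  have "x \<cdot>\<^sub>m 1\<^sub>m ?n - sg_adj_matrix (bouquet ts) = bouquet_char_mat ts x x"
    by (rule eq_matI)
      (auto simp: sg_adj_matrix_bouquet bouquet_char_mat_def bouquet_weight_singleton)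
  then show ?thesis
    using poly_char_poly[of "sg_adj_matrix (bouquet ts)" ?n x] by (simp add: sg_adj_matrix_bouquet)
qed

lemma tendsto_sum_list:
  fixes f :: "'a \<Rightarrow> 'b \<Rightarrow> real"
  assumes "\<And>t. (f t \<longlongrightarrow> l t) F"
  shows "((\<lambda>x. \<Sum>t\<leftarrow>ts. f t x) \<longlongrightarrow> (\<Sum>t\<leftarrow>ts. l t)) F"
  by (induction ts) (simp_all add: tendsto_add assms)

lemma tendsto_prod_list:
  fixes f :: "'a \<Rightarrow> 'b \<Rightarrow> real"
  assumes "\<And>t. (f t \<longlongrightarrow> l t) F"
  shows "((\<lambda>x. \<Prod>t\<leftarrow>ts. f t x) \<longlongrightarrow> (\<Prod>t\<leftarrow>ts. l t)) F"
  by (induction ts) (simp_all add: tendsto_mult assms)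

lemma tendsto_coupling: "(coupling t \<longlongrightarrow> coupling t 0) (at 0)"
  by (cases t) (auto simp: coupling.simps[abs_def] intro!: tendsto_eq_intros)

lemma tendsto_block_cofactor: "(block_cofactor t \<longlongrightarrow> block_cofactor t 0) (at 0)"
  by (cases t) (auto simp: block_cofactor.simps[abs_def] intro!: tendsto_eq_intros)

text \<open>With \<open>S\<close> the sum of the couplings, multiplying the centre factor
  \<open>x - S / x\<close> by \<open>x\<close> gives \<open>x\<^sup>2 - S\<close>, whose limit at 0
  is nonzero. This one extra factor \<open>x\<close> is the \<open>+ 1\<close> in the
  statement.\<close>

lemma sg_nullity_bouquet:
  assumes "Leaves \<in> set ts"
  shows "sg_nullity (bouquet ts) + 1 = (\<Sum>t\<leftarrow>ts. block_nullity t)"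
proof -
  let ?h = "\<lambda>x. (\<Prod>t\<leftarrow>ts. block_cofactor t x) * (x\<^sup>2 - (\<Sum>t\<leftarrow>ts. coupling t x))"
  have "eventually (\<lambda>x :: real. x \<noteq> 0 \<and> \<bar>x\<bar> < 1) (at 0)"
    unfolding eventually_at by (rule exI[of _ 1]) (auto simp: dist_real_def)
  then have "eventually (\<lambda>x. poly (char_poly (sg_adj_matrix (bouquet ts))) x * x ^ 1 =
      x ^ (\<Sum>t\<leftarrow>ts. block_nullity t) * ?h x) (at 0)"
  proof eventually_elim
    case (elim x)
    then show ?case
      by (simp add: poly_char_poly_bouquet det_bouquet_char_mat power2_eq_square right_diff_distrib
          left_diff_distrib)
  qed
  moreover have "(?h \<longlongrightarrow> ?h 0) (at 0)"
    by (intro tendsto_intros tendsto_sum_list tendsto_prod_list tendsto_coupling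
        tendsto_block_cofactor)
  moreover have "?h 0 \<noteq> 0"
  proof -
    have "block_cofactor t 0 \<noteq> 0" for t by (cases t) auto
    then have "(\<Prod>t\<leftarrow>ts. block_cofactor t 0) \<noteq> 0" by (induction ts) auto
    \<comment> \<open>The values at 0 are 4, 1, 1/2 and 0 in the order of the constructors, so
      nothing cancels and one \<open>Leaves\<close> makes the sum positive.\<close>
    moreover have "(\<Sum>t\<leftarrow>ts. coupling t 0) > 0"
    proof -
      have "coupling t 0 \<ge> 0" for t by (cases t) auto
      then have nonneg: "(\<Sum>t\<leftarrow>us. coupling t 0) \<ge> 0" for us
        by (induction us) simp_all
      obtain us vs where "ts = us @ Leaves # vs" using split_list[OF assms] by blast
      then show ?thesis using nonneg[of us] nonneg[of vs] by simp
    qed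
    ultimately show ?thesis by simp
  qed
  ultimately show ?thesis
    unfolding sg_nullity_def by (rule order_0_from_asymptotics(2))
qed

section \<open>Choice of the parameters and the infinite family\<close>

text \<open>In each residue class modulo 3 the chosen \<open>a + b\<close> is \<open>s / 3\<close>
  rounded up, hence at most \<open>c\<close>; \<open>d\<close> fills the gap.\<close>

lemma exists_3_2_decomposition:
  fixes c s :: int
  assumes "0 \<le> s" and "s \<le> 3 * c" and "s \<noteq> 1"
  shows "\<exists>a b d :: nat. s = 3 * int a + 2 * int b \<and> c = int a + int b + int d"
proof -
  define q r where "q = s div 3" and "r = s mod 3"
  have s: "s = 3 * q + r" "0 \<le> r" "r < 3" by (simp_all add: q_def r_def)
  have decompose: ?thesis
    if "0 \<le> a" "0 \<le> b" "s = 3 * a + 2 * b" "a + b \<le> c" for a b :: int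
    by (rule exI[of _ "nat a"], rule exI[of _ "nat b"], rule exI[of _ "nat (c - a - b)"])
      (use that in simp)
  consider "r = 0" | "r = 1" | "r = 2" using s by linarith
  then show ?thesis
  proof cases
    case 1
    show ?thesis by (rule decompose[of q 0]) (use assms s 1 in auto)
  next
    case 2
    \<comment> \<open>Here \<open>s = 3 * (q - 1) + 2 * 2\<close>, which needs \<open>q\<close> to
      be positive; this is where \<open>s = 1\<close> is excluded.\<close>
    then have "q \<noteq> 0" using assms(3) s(1) by simp
    then have "q \<ge> 1" using assms(1) s(1) 2 by simp
    show ?thesis by (rule decompose[of "q - 1" 2]) (use assms \<open>q \<ge> 1\<close> s(1) 2 in simp_all)
  next
    case 3
    show ?thesis by (rule decompose[of q 1]) (use assms s 3 in auto)
  qed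
qed

lemma sg_isomorphic_imp_card_verts_eq: "sg_isomorphic G H \<Longrightarrow> card (sg_verts G) = card (sg_verts H)"
  unfolding sg_isomorphic_def by (auto dest: bij_betw_same_card)

theorem theorem5p1:
  fixes c s :: int
  assumes "c \<ge> 0" and "0 \<le> s" and "s \<le> 3 * c" and "s \<noteq> 1"
  shows "\<exists>S :: nat signed_graph set.
           infinite S \<and>
           (\<forall>G \<in> S. \<forall>H \<in> S. sg_isomorphic G H \<longrightarrow> G = H) \<and>
           (\<forall>G \<in> S. is_signed_graph G \<and> sg_connected G \<and> cyclomatic_number G = c \<and>
              int (sg_nullity G) =
                int (card (sg_verts G)) - 2 * int (matching_number G)
                  + 2 * cyclomatic_number G - s)"
proof -
  obtain a b d :: nat where abd: "s = 3 * int a + 2 * int b" "c = int a + int b + int d"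
    using exists_3_2_decomposition assms(2-4) by blast
  \<comment> \<open>The separate final \<open>Leaves\<close> supplies the pole and the free leaf 1
    even when \<open>m = 0\<close>; \<open>m\<close> only varies the size.\<close>
  define ts where "ts m = (replicate a Triangle @ replicate b Unbalanced_Square @
    replicate d Balanced_Square @ replicate m Leaves) @ [Leaves]" for m
  let ?G = "\<lambda>m. bouquet (ts m)"
  have card: "card (sg_verts (?G m)) = 4 * (a + b + d + m + 1) + 1" for m
    by (simp add: ts_def)
  have cyc: "cyclomatic_number (?G m) = c" for m
    by (simp add: cyclomatic_number_bouquet ts_def sum_list_replicate abd)
  have match: "matching_number (?G m) = a + 2 * b + 2 * d + 1" for m
    unfolding ts_def matching_number_bouquet by (simp add: sum_list_replicate)
  have "sg_nullity (?G m) + 1 = a + 2 * d + 4 * (m + 1)" for m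
    by (subst sg_nullity_bouquet) (simp_all add: ts_def sum_list_replicate)
  then have "sg_nullity (?G m) + 1 = (a + 2 * d + 4 * m + 3) + 1" for m by simp
  then have nullity_nat: "sg_nullity (?G m) = a + 2 * d + 4 * m + 3" for m
    by (simp only: add_right_cancel)
  \<comment> \<open>Four vertices, minus twice the matching number, plus two per cycle, minus the
    share of \<open>s\<close>, gives 1, 0, 2 and 4 for triangle, unbalanced square, balanced square
    and leaves: the block nullities. The centre vertex and its matching edge give 1 - 2 =
    -1.\<close>
  have nullity: "int (sg_nullity (?G m)) =
    int (card (sg_verts (?G m))) - 2 * int (matching_number (?G m)) +
      2 * cyclomatic_number (?G m) - s" for m
    unfolding card match cyc nullity_nat by (simp add: abd)
  \<comment> \<open>The number of vertices determines \<open>m\<close>, so it already separates the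
    isomorphism classes.\<close>
  have iso: "m = m'" if "sg_isomorphic (?G m) (?G m')" for m m'
    using sg_isomorphic_imp_card_verts_eq[OF that] unfolding card by simp
  have "inj ?G"
  proof (rule injI)
    fix m m' assume "?G m = ?G m'"
    then have "card (sg_verts (?G m)) = card (sg_verts (?G m'))" by simp
    then show "m = m'" unfolding card by simp
  qed
  then have "infinite (range ?G)" by (rule range_inj_infinite)
  moreover have "\<forall>G \<in> range ?G. \<forall>H \<in> range ?G. sg_isomorphic G H \<longrightarrow> G = H"
    using iso by blast
  ultimately show ?thesis
    using is_signed_graph_bouquet sg_connected_bouquet cyc nullity
    by (intro exI[of _ "range ?G"]) blast
qed

end
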